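(* Let $X$ be a Banach space and let $\mathcal{K}$ be a compact set contained in the unit ball of $X$. Assume that there are constants $C_1,C_2>0$ and real numbers $\mu,s$ with $0<\mu\le \frac12$ and $s>\mu$ such that $$\gamma_n(X)\le C_1 n^{\mu}\qquad\text{and}\qquad d_n(\mathcal{K})_X\le C_2 n^{-s}\qquad\text{for all } n\ge 1 .$$ Then there exists a constant $C>0$ such that $$\sigma_n(\mathcal{K})_X\le C\, n^{-s+\mu}\big(\log(n+2)\big)^{s}\qquad\text{for all } n\ge 1 .$$
   Context: Greedy algorithm: for a (nonempty) compact set $\mathcal{K}$ in a Banach space $X$, choose $f_0\in\mathcal{K}$ with $\|f_0\|_X=\max_{f\in\mathcal{K}}\|f\|_X$; having chosen $f_0,\dots,f_{n-1}$, put $V_n=\operatorname{span}\{f_0,\dots,f_{n-1}\}$ and choose $f_n\in\mathcal{K}$ with $\operatorname{dist}(f_n,V_n)_X=\max_{f\in\mathcal{K}}\operatorname{dist}(f,V_n)_X$, where $\operatorname{dist}(f,V)_X=\inf_{g\in V}\|f-g\|_X$. Set $\sigma_0(\mathcal{K})_X=\|f_0\|_X$ and $\sigma_n(\mathcal{K})_X=\operatorname{dist}(f_n,V_n)_X$ for $n\ge1$. The sequences $(f_n)$ and $(\sigma_n(\mathcal{K})_X)$ need not be unique; the statement concerns any sequence produced by this algorithm. Kolmogorov widths: for $n\ge 1$, $d_n(\mathcal{K})_X=\inf_L\sup_{f\in\mathcal{K}}\operatorname{dist}(f,L)_X$, the infimum over all $n$-dimensional subspaces $L$ of $X$ (if $\dim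 X<n$, over subspaces of dimension at most $n$). Banach–Mazur distance: for isomorphic Banach spaces $Y,Z$, $d(Y,Z)=\inf\{\|T\|\,\|T^{-1}\| : T:Y\to Z \text{ an isomorphism}\}$. For $n\ge1$, $\gamma_n(X)=\sup\{d(V,\ell_2^n): V \text{ an } n\text{-dimensional subspace of } X\}$ (the supremum of the empty set being $0$). *)

theory Defs
  imports "HOL-Analysis.Analysis"
begin

definition greedy_space :: "(nat \<Rightarrow> 'a::real_normed_vector) \<Rightarrow> nat \<Rightarrow> 'a set" where
  "greedy_space f n = span (f ` {..<n})"

definition greedy_sequence :: "'a::real_normed_vector set \<Rightarrow> (nat \<Rightarrow> 'a) \<Rightarrow> bool" where
  "greedy_sequence K f \<longleftrightarrow>
     (\<forall>n. f n \<in> K) \<and>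
     (\<forall>g\<in>K. norm g \<le> norm (f 0)) \<and>
     (\<forall>n\<ge>1. \<forall>g\<in>K. infdist g (greedy_space f n) \<le> infdist (f n) (greedy_space f n))"

definition greedy_error :: "(nat \<Rightarrow> 'a::real_normed_vector) \<Rightarrow> nat \<Rightarrow> real" where
  "greedy_error f n = (if n = 0 then norm (f 0) else infdist (f n) (greedy_space f n))"

text \<open>The constant \<^const>\<open>dim\<close> is \<open>0\<close> on infinite-dimensional spaces, so finite
  dimensionality is required separately.\<close>

definition n_dim_subspaces :: "nat \<Rightarrow> 'a::real_vector set set" where
  "n_dim_subspaces n = {V. subspace V \<and> (\<exists>B. finite B \<and> span B = V) \<and> dim V = n}"

text \<open>Suprema and infima of nonnegative quantities are taken in \<^typ>\<open>ennreal\<close>, where they always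
  exist, and where the supremum of the empty set is \<open>0\<close>.\<close>

definition kolmogorov_width :: "nat \<Rightarrow> 'a::real_normed_vector set \<Rightarrow> ennreal" where
  "kolmogorov_width n K =
     (INF L \<in> (if (n_dim_subspaces n :: 'a set set) \<noteq> {} then n_dim_subspaces n
               else (\<Union>m\<le>n. n_dim_subspaces m)).
        SUP f\<in>K. ennreal (infdist f L))"

text \<open>The dimension of \<open>\<ell>\<^sub>2\<^sup>n\<close> varies inside one statement, so normed spaces are represented here by
  explicit carriers, operations and norms rather than by types.\<close>

record 'a nspace =
  vecs :: "'a set"
  vadd :: "'a \<Rightarrow> 'a \<Rightarrow> 'a"
  vscale :: "real \<Rightarrow> 'a \<Rightarrow> 'a"
  vnorm :: "'a \<Rightarrow> real"

definition subspace_nspace :: "'a::real_normed_vector set \<Rightarrow> 'a nspace" where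
  "subspace_nspace V = \<lparr>vecs = V, vadd = (+), vscale = scaleR, vnorm = norm\<rparr>"

text \<open>As for \<^const>\<open>Euclidean_space\<close>, vectors of length \<open>n\<close> are sequences vanishing from index \<open>n\<close>
  on.\<close>

definition ell2 :: "nat \<Rightarrow> (nat \<Rightarrow> real) nspace" where
  "ell2 n = \<lparr>vecs = {x. \<forall>i\<ge>n. x i = 0}, vadd = (\<lambda>x y i. x i + y i),
             vscale = (\<lambda>c x i. c * x i), vnorm = (\<lambda>x. L2_set x {..<n})\<rparr>"

definition linear_between :: "'a nspace \<Rightarrow> 'b nspace \<Rightarrow> ('a \<Rightarrow> 'b) \<Rightarrow> bool" where
  "linear_between Y Z T \<longleftrightarrow>
     (\<forall>x\<in>vecs Y. T x \<in> vecs Z) \<and>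
     (\<forall>x\<in>vecs Y. \<forall>y\<in>vecs Y. T (vadd Y x y) = vadd Z (T x) (T y)) \<and>
     (\<forall>c. \<forall>x\<in>vecs Y. T (vscale Y c x) = vscale Z c (T x))"

definition op_norm :: "'a nspace \<Rightarrow> 'b nspace \<Rightarrow> ('a \<Rightarrow> 'b) \<Rightarrow> ennreal" where
  "op_norm Y Z T = (SUP x\<in>{x \<in> vecs Y. vnorm Y x \<le> 1}. ennreal (vnorm Z (T x)))"

definition isomorphism_between :: "'a nspace \<Rightarrow> 'b nspace \<Rightarrow> ('a \<Rightarrow> 'b) \<Rightarrow> bool" where
  "isomorphism_between Y Z T \<longleftrightarrow>
     linear_between Y Z T \<and> bij_betw T (vecs Y) (vecs Z) \<and>
     op_norm Y Z T < \<infinity> \<and> op_norm Z Y (inv_into (vecs Y) T) < \<infinity>"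

definition banach_mazur_dist :: "'a nspace \<Rightarrow> 'b nspace \<Rightarrow> ennreal" where
  "banach_mazur_dist Y Z =
     (INF T \<in> {T. isomorphism_between Y Z T}.
        op_norm Y Z T * op_norm Z Y (inv_into (vecs Y) T))"

definition bm_gamma :: "'a::real_normed_vector itself \<Rightarrow> nat \<Rightarrow> ennreal" where
  "bm_gamma _ n =
     (SUP V \<in> (n_dim_subspaces n :: 'a set set). banach_mazur_dist (subspace_nspace V) (ell2 n))"

end

(* The volume spanned by f_0, ..., f_(n-1) in a Hilbert norm that is Gamma-equivalent to the given
   norm on W = span {f_0, ..., f_(n-1)} + L, where L is a near-optimal m-dimensional subspace,
   dominates the product of the first n greedy errors, hence sigma_n^n.  Writing f_i = u_i + w_i with
   u_i in L and w_i of size about Gamma * d_m, and expanding multilinearly, each nonzero term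
   contains at most m of the u_i, so sigma_n^n <= (c Gamma)^n d_m^(n-m), where Gamma is of order
   n^mu because dim W <= 2n.  Take m of order n / ln n. *)

theory Submission
  imports Defs
begin

section \<open>Gram determinants by Schur complements\<close>

text \<open>A semi-inner product on the whole type. Degeneracy has to be allowed, since elimination
  turns vectors into null vectors.\<close>

definition psd :: "('a::real_vector \<Rightarrow> 'a \<Rightarrow> real) \<Rightarrow> bool" where
  "psd q \<longleftrightarrow> (\<forall>y. linear (\<lambda>x. q x y)) \<and> (\<forall>x y. q x y = q y x) \<and> (\<forall>x. 0 \<le> q x x)"

lemma psdD:
  assumes "psd q"
  shows psd_linear: "linear (\<lambda>x. q x y)"
    and psd_commute: "q x y = q y x"
    and psd_nonneg: "0 \<le> q x x"
    and psd_add_left: "q (x + z) y = q x y + q z y"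
    and psd_diff_left: "q (x - z) y = q x y - q z y"
    and psd_scale_left: "q (c *\<^sub>R x) y = c * q x y"
    and psd_add_right: "q y (x + z) = q y x + q y z"
    and psd_diff_right: "q y (x - z) = q y x - q y z"
    and psd_scale_right: "q y (c *\<^sub>R x) = c * q y x"
proof -
  have lin: "linear (\<lambda>x. q x y)" for y using assms unfolding psd_def by blast
  have comm: "q x y = q y x" for x y using assms unfolding psd_def by blast
  have nn: "0 \<le> q x x" for x using assms unfolding psd_def by blast
  show "linear (\<lambda>x. q x y)" by (rule lin)
  show "q x y = q y x" by (rule comm)
  show "0 \<le> q x x" by (rule nn)
  show add: "q (x + z) y = q x y + q z y" for x z y using linear_add[OF lin] .
  show diff: "q (x - z) y = q x y - q z y" for x z y using linear_diff[OF lin] .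
  show scale: "q (c *\<^sub>R x) y = c * q x y" for c x y using linear_scale[OF lin] by simp
  show "q y (x + z) = q y x + q y z" by (metis add comm)
  show "q y (x - z) = q y x - q y z" by (metis diff comm)
  show "q y (c *\<^sub>R x) = c * q y x" by (metis scale comm)
qed

lemma psd_null:
  assumes q: "psd q" and "q y y = 0"
  shows "q x y = 0"
proof (rule ccontr)
  assume nz: "q x y \<noteq> 0"
  \<comment> \<open>As \<open>q y y = 0\<close>, the form at \<open>x + t *\<^sub>R y\<close> is
    affine in \<open>t\<close> with slope \<open>2 * q x y\<close>; this \<open>t\<close> is where
    it takes the value \<open>-1\<close>.\<close>
  define t where "t = - (q x x + 1) / (2 * q x y)"
  have "q (x + t *\<^sub>R y) (x + t *\<^sub>R y) = q x x + 2 * t * q x y"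
    using assms by (simp add: psd_add_left psd_add_right psd_scale_left psd_scale_right
        psd_commute[OF q, of y x])
  also have "\<dots> = -1" using nz by (simp add: t_def field_simps)
  finally show False using psd_nonneg[OF q, of "x + t *\<^sub>R y"] by linarith
qed

lemma psd_null_right: "psd q \<Longrightarrow> q y y = 0 \<Longrightarrow> q y x = 0"
  using psd_null[of q y x] psd_commute[of q x y] by simp

text \<open>The form on components orthogonal to \<open>a\<close>. If \<open>q a a = 0\<close>,
  division by zero returns \<open>q\<close> itself, which is consistent because \<open>a\<close> is
  then already null for a semidefinite \<open>q\<close>.\<close>

definition schur :: "('a::real_vector \<Rightarrow> 'a \<Rightarrow> real) \<Rightarrow> 'a \<Rightarrow> 'a \<Rightarrow> 'a \<Rightarrow> real" where
  "schur q a = (\<lambda>x y. q x y - q x a * q a y / q a a)"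

text \<open>Here \<open>c\<close> is the coefficient of the orthogonal projection of
  \<open>x\<close> onto \<open>a\<close>, with \<open>c = 0\<close> when \<open>a\<close> is
  null.\<close>

lemma schur_eq_residual:
  assumes q: "psd q"
  obtains c where "schur q a x x = q (x - c *\<^sub>R a) (x - c *\<^sub>R a)"
proof (cases "q a a = 0")
  case True
  then have "schur q a x x = q (x - 0 *\<^sub>R a) (x - 0 *\<^sub>R a)" by (simp add: schur_def)
  then show ?thesis by (rule that)
next
  case False
  define c where "c = q x a / q a a"
  have "schur q a x x = q (x - c *\<^sub>R a) (x - c *\<^sub>R a)"
    using q False
    by (simp add: schur_def c_def psd_diff_left psd_diff_right psd_scale_left psd_scale_right
        psd_commute[OF q, of a x])
  then show ?thesis by (rule that)
qed

lemma psd_schur: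
  assumes q: "psd q"
  shows "psd (schur q a)"
  unfolding psd_def
proof (intro conjI allI)
  fix x y
  show "linear (\<lambda>x. schur q a x y)"
    by (rule linearI)
      (simp_all add: schur_def psd_add_left[OF q] psd_scale_left[OF q] distrib_right
        add_divide_distrib right_diff_distrib)
  show "schur q a x y = schur q a y x"
    by (simp add: schur_def psd_commute[OF q, of y x] psd_commute[OF q, of y a]
        psd_commute[OF q, of x a] mult.commute)
  show "0 \<le> schur q a x x"
    by (metis schur_eq_residual psd_nonneg q)
qed

lemma schur_le:
  assumes q: "psd q"
  shows "schur q a x x \<le> q x x"
  by (simp add: schur_def psd_commute[OF q, of a x] psd_nonneg[OF q])

text \<open>This is nonnegativity of the Schur complement by \<open>y\<close>, multiplied by
  \<open>q y y\<close>.\<close>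

lemma psd_Cauchy_Schwarz:
  assumes q: "psd q"
  shows "(q x y)\<^sup>2 \<le> q x x * q y y"
proof (cases "q y y = 0")
  case True
  then show ?thesis using psd_null[OF q True] by simp
next
  case False
  then have pos: "q y y > 0" using psd_nonneg[OF q, of y] by linarith
  have "0 \<le> schur q y x x" by (rule psd_nonneg[OF psd_schur[OF q]])
  then show ?thesis
    using pos by (simp add: schur_def psd_commute[OF q, of y x] field_simps power2_eq_square)
qed

lemma psd_triangle:
  assumes q: "psd q"
  shows "sqrt (q (x + y) (x + y)) \<le> sqrt (q x x) + sqrt (q y y)"
proof (rule real_le_lsqrt)
  have "q x y \<le> sqrt (q x x * q y y)"
    using psd_Cauchy_Schwarz[OF q, of x y] by (rule real_le_rsqrt)
  then show "q (x + y) (x + y) \<le> (sqrt (q x x) + sqrt (q y y))\<^sup>2"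
    using psd_nonneg[OF q]
    by (simp add: power2_sum psd_add_left[OF q] psd_add_right[OF q] psd_commute[OF q, of y x]
        real_sqrt_mult)
qed (simp add: psd_nonneg[OF q])

section \<open>Gram determinants and their symmetry\<close>

text \<open>The determinant of the matrix of values \<open>q\<close> on the list, as the product of
  its elimination pivots. Its square root is the volume of the spanned parallelepiped.\<close>

fun gram :: "('a::real_vector \<Rightarrow> 'a \<Rightarrow> real) \<Rightarrow> 'a list \<Rightarrow> real" where
  "gram q [] = 1"
| "gram q (a # l) = q a a * gram (schur q a) l"

lemma gram_append: "gram q (k @ l) = gram q k * gram (foldl schur q k) l"
  by (induction k arbitrary: q) auto

lemma psd_foldl_schur: "psd q \<Longrightarrow> psd (foldl schur q l)"
  by (induction l arbitrary: q) (auto intro: psd_schur)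

lemma gram_nonneg: "psd q \<Longrightarrow> 0 \<le> gram q l"
  by (induction l arbitrary: q) (auto intro!: mult_nonneg_nonneg simp: psd_nonneg psd_schur)

lemma foldl_schur_le: "psd q \<Longrightarrow> foldl schur q l x x \<le> q x x"
proof (induction l arbitrary: q)
  case (Cons a l)
  then show ?case using schur_le[of q a x] psd_schur[of q a] by fastforce
qed simp

text \<open>Hadamard's inequality: elimination only decreases the diagonal, so each pivot is at most
  the original \<open>q x x\<close>.\<close>

lemma gram_le_power:
  assumes "psd q" and "\<And>x. x \<in> set l \<Longrightarrow> q x x \<le> r"
  shows "gram q l \<le> r ^ length l"
  using assms
proof (induction l arbitrary: q)
  case (Cons a l)
  have "gram (schur q a) l \<le> r ^ length l"
  proof (rule Cons.IH)
    fix x assume "x \<in> set l"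
    then show "schur q a x x \<le> r"
      using schur_le[OF Cons.prems(1), of a x] Cons.prems(2)[of x] by simp
  qed (simp add: psd_schur Cons.prems)
  moreover have "0 \<le> r" using Cons.prems(2)[of a] psd_nonneg[OF Cons.prems(1), of a] by simp
  ultimately show ?case
    using Cons.prems(2)[of a] gram_nonneg[OF psd_schur[OF Cons.prems(1)], of a l]
    by (auto intro: mult_mono)
qed simp

text \<open>Two eliminations amount to one by the inverse of the 2 by 2 Gram matrix of
  \<open>a\<close> and \<open>b\<close>. The right-hand side is visibly symmetric in
  \<open>a\<close> and \<open>b\<close>, which is what exchanging neighbours requires.\<close>

lemma schur_schur_eq:
  assumes q: "psd q" and a: "q a a \<noteq> 0" and D: "q a a * q b b - q a b * q a b \<noteq> 0"
  shows "schur (schur q a) b x y = q x y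
    - (q x a * q a y * q b b + q x b * q b y * q a a - q a b * (q x a * q b y + q x b * q a y))
      / (q a a * q b b - q a b * q a b)"
proof -
  let ?A = "q a a" and ?c = "q a b" and ?D = "q a a * q b b - q a b * q a b"
  have ba: "q b a = ?c" by (rule psd_commute[OF q])
  have b: "schur q a b b = ?D / ?A" using a by (simp add: schur_def ba field_simps)
  have xb: "schur q a x b = (?A * q x b - ?c * q x a) / ?A"
    and yb: "schur q a b y = (?A * q b y - ?c * q a y) / ?A"
    using a by (simp_all add: schur_def ba field_simps)
  have "q x a * q a y / ?A + schur q a x b * schur q a b y / schur q a b b
      = (q x a * q a y * ?D + (?A * q x b - ?c * q x a) * (?A * q b y - ?c * q a y)) / (?A * ?D)"
    unfolding b xb yb using a D by (simp add: add_divide_distrib)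
  also have "q x a * q a y * ?D + (?A * q x b - ?c * q x a) * (?A * q b y - ?c * q a y)
      = ?A * (q x a * q a y * q b b + q x b * q b y * q a a - q a b * (q x a * q b y + q x b * q a y))"
    by algebra
  finally show ?thesis using a unfolding schur_def[of "schur q a"] by (simp add: schur_def[of q])
qed

text \<open>If \<open>a\<close> or \<open>b\<close> is null, or the 2 by 2 minor vanishes, both
  sides are zero. Otherwise the first two pivots multiply to that minor in either order, and the
  remaining forms agree by symmetry of the double Schur complement.\<close>

lemma gram_swap:
  assumes q: "psd q"
  shows "gram q (a # b # l) = gram q (b # a # l)"
proof (cases "q a a = 0 \<or> q b b = 0")
  case True
  then have "q a b = 0" "q b a = 0" "q a a * q b b = 0"
    by (auto intro: psd_null[OF q] psd_null_right[OF q])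
  then show ?thesis by (auto simp: schur_def)
next
  case False
  have ba: "q b a = q a b" by (rule psd_commute[OF q])
  let ?D = "q a a * q b b - q a b * q a b"
  have sa: "schur q a b b = ?D / q a a" and sb: "schur q b a a = ?D / q b b"
    using False by (simp_all add: schur_def ba diff_divide_distrib)
  show ?thesis
  proof (cases "?D = 0")
    case True
    then show ?thesis by (simp add: sa sb)
  next
    case nz: False
    have "schur (schur q a) b x y = schur (schur q b) a x y" for x y
    proof -
      have D: "q b b * q a a - q b a * q b a = ?D" by (simp add: ba mult.commute)
      have "q x b * q b y * q a a + q x a * q a y * q b b - q b a * (q x b * q a y + q x a * q b y)
          = q x a * q a y * q b b + q x b * q b y * q a a - q a b * (q x a * q b y + q x b * q a y)"
        unfolding ba by simp
      then show ?thesis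
        using schur_schur_eq[OF q, of a b x y] schur_schur_eq[OF q, of b a x y] False nz
        unfolding D by simp
    qed
    then have "schur (schur q a) b = schur (schur q b) a" by blast
    then show ?thesis using False by (simp add: sa sb)
  qed
qed

lemma gram_move_front:
  assumes "psd q"
  shows "gram q (k @ x # l) = gram q (x # k @ l)"
  using assms
proof (induction k arbitrary: q)
  case (Cons a k)
  have "gram q (a # k @ x # l) = gram q (a # x # k @ l)"
    using Cons.IH[OF psd_schur[OF Cons.prems]] by simp
  also have "\<dots> = gram q (x # a # k @ l)" by (rule gram_swap[OF Cons.prems])
  finally show ?case by simp
qed simp

lemma gram_permute:
  assumes "psd q" and "mset k = mset l"
  shows "gram q k = gram q l"
  using assms
proof (induction k arbitrary: q l)
  case (Cons a k)
  have "a \<in> set l" using mset_eq_setD[OF Cons.prems(2)] by auto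
  then obtain l1 l2 where l: "l = l1 @ a # l2" by (meson split_list)
  then have "mset k = mset (l1 @ l2)" using Cons.prems(2) by simp
  then have "gram (schur q a) k = gram (schur q a) (l1 @ l2)"
    by (rule Cons.IH[OF psd_schur[OF Cons.prems(1)]])
  then show ?case using gram_move_front[OF Cons.prems(1), of l1 a l2] l by simp
qed simp

section \<open>Subadditivity, linear dependence and the volume expansion\<close>

text \<open>Eliminating the head last makes the determinant a constant times a semidefinite form in
  the head, so the triangle inequality of that form applies.\<close>

lemma sqrt_gram_Cons_add_le:
  assumes q: "psd q"
  shows "sqrt (gram q ((u + w) # l)) \<le> sqrt (gram q (u # l)) + sqrt (gram q (w # l))"
proof -
  let ?p = "foldl schur q l"
  have last: "gram q (x # l) = gram q l * ?p x x" for x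
    using gram_move_front[OF q, of l x "[]"] by (simp add: gram_append)
  have "sqrt (gram q l) * sqrt (?p (u + w) (u + w))
      \<le> sqrt (gram q l) * (sqrt (?p u u) + sqrt (?p w w))"
    by (intro mult_left_mono psd_triangle psd_foldl_schur q) (simp add: gram_nonneg q)
  then show ?thesis unfolding last by (simp add: real_sqrt_mult distrib_left)
qed

lemma foldl_schur_null:
  assumes "\<And>y. q x y = 0"
  shows "foldl schur q l x y = 0"
  using assms
proof (induction l arbitrary: q y)
  case (Cons a l)
  have "schur q a x z = 0" for z by (simp add: schur_def Cons.prems)
  then show ?case by (simp add: Cons.IH)
qed simp

text \<open>Eliminating a vector makes it null, and later eliminations keep null vectors
  null.\<close>

lemma foldl_schur_mem:
  assumes "psd q" and "x \<in> set l"
  shows "foldl schur q l x y = 0"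
  using assms
proof (induction l arbitrary: q)
  case (Cons a l)
  show ?case
  proof (cases "x = a")
    case True
    have "schur q a a z = 0" for z
      by (cases "q a a = 0") (simp_all add: schur_def psd_null_right[OF Cons.prems(1)])
    then show ?thesis using True by (simp add: foldl_schur_null)
  next
    case False
    then show ?thesis using Cons.prems Cons.IH[OF psd_schur] by simp
  qed
qed simp

lemma foldl_schur_span:
  assumes "psd q" and "x \<in> span (set l)"
  shows "foldl schur q l x y = 0"
  using linear_eq_0_on_span[OF psd_linear[OF psd_foldl_schur[OF assms(1)]], of "set l" l y]
    foldl_schur_mem[OF assms(1)] assms(2) by blast

text \<open>Induction from the right: a vector in the span of its predecessors would have pivot
  zero.\<close>

lemma gram_nonzero_independent:
  assumes "psd q" and "gram q l \<noteq> 0"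
  shows "distinct l \<and> independent (set l)"
  using assms(2)
proof (induction l rule: rev_induct)
  case (snoc x l)
  then have "gram q l \<noteq> 0" and "foldl schur q l x x \<noteq> 0" by (auto simp: gram_append)
  then have "x \<notin> span (set l)" using foldl_schur_span[OF assms(1)] by blast
  then show ?case
    using snoc.IH \<open>gram q l \<noteq> 0\<close> by (auto simp: independent_insert span_base)
qed (simp add: independent_empty)

text \<open>The finite \<open>B\<close> certifies that \<open>dim M\<close> is a genuine dimension
  and not the default value \<open>0\<close>.\<close>

lemma gram_zero_of_dim_less:
  assumes q: "psd q" and "set l \<subseteq> M" and "finite B" and "M \<subseteq> span B" and "dim M < length l"
  shows "gram q l = 0"
proof (rule ccontr)
  assume "gram q l \<noteq> 0"
  then have "distinct l" and ind: "independent (set l)"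
    using gram_nonzero_independent[OF q] by auto
  obtain C where C: "C \<subseteq> M" "independent C" "M \<subseteq> span C" "card C = dim M"
    using basis_exists by blast
  have "finite C"
    using independent_span_bound[OF assms(3) C(2)] C(1) assms(4) by blast
  then have "card (set l) \<le> card C"
    using independent_span_bound[OF _ ind] C(3) assms(2) by blast
  then show False using assms(5) C(4) distinct_card[OF \<open>distinct l\<close>] by simp
qed

text \<open>Multilinear expansion of the volume: a product term survives only if at most \<open>m\<close> of its
  factors come from the subspace \<open>M\<close>.\<close>

lemma sqrt_gram_expand:
  assumes q: "psd q" and M: "finite B" "M \<subseteq> span B" "dim M \<le> m"
    and e: "0 \<le> e" "e \<le> r"
    and V: "\<And>v. v \<in> set V \<Longrightarrow> \<exists>u w. v = u + w \<and> u \<in> M \<and> sqrt (q u u) \<le> r \<and> sqrt (q w w) \<le> e"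
    and A: "set A \<subseteq> M" "\<And>u. u \<in> set A \<Longrightarrow> sqrt (q u u) \<le> r"
    and W: "\<And>w. w \<in> set W \<Longrightarrow> sqrt (q w w) \<le> e"
    and m: "m \<le> length V + length A + length W"
  shows "sqrt (gram q (V @ A @ W))
    \<le> 2 ^ length V * (r ^ m * e ^ (length V + length A + length W - m))"
  using V A W m
\<comment> \<open>\<open>V\<close> holds the vectors still to be split, \<open>A\<close> the chosen
  summands in \<open>M\<close>, and \<open>W\<close> the chosen small summands.\<close>
proof (induction V arbitrary: A W)
  case Nil
  show ?case
  proof (cases "length A \<le> m")
    case True
    have sq: "x \<le> c\<^sup>2" if "sqrt x \<le> c" for x c :: real
      using that sqrt_le_D by blast
    have pA: "gram q A \<le> (r\<^sup>2) ^ length A"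
      by (rule gram_le_power[OF q]) (rule sq, rule Nil.prems)
    have "gram (foldl schur q A) W \<le> (e\<^sup>2) ^ length W"
    proof (rule gram_le_power[OF psd_foldl_schur[OF q]])
      fix x assume "x \<in> set W"
      then have "q x x \<le> e\<^sup>2" by (intro sq Nil.prems)
      then show "foldl schur q A x x \<le> e\<^sup>2" using foldl_schur_le[OF q, of A x] by linarith
    qed
    then have "gram q (A @ W) \<le> (r\<^sup>2) ^ length A * (e\<^sup>2) ^ length W"
      unfolding gram_append using pA e
      by (intro mult_mono gram_nonneg psd_foldl_schur q) auto
    also have "\<dots> = (r ^ length A * e ^ length W)\<^sup>2"
      by (simp add: power_mult_distrib flip: power_mult) (simp add: mult.commute)
    finally have "sqrt (gram q (A @ W)) \<le> r ^ length A * e ^ length W"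
      using e by (intro real_le_lsqrt) (auto intro: gram_nonneg[OF q])
    \<comment> \<open>With at most \<open>m\<close> factors from \<open>M\<close>, exactly
      \<open>m - length A\<close> of the factors \<open>e\<close> are weakened to \<open>r\<close>,
      so that all terms share one bound.\<close>
    also have "e ^ length W = e ^ (m - length A) * e ^ (length A + length W - m)"
      using Nil.prems True by (simp flip: power_add)
    also have "r ^ length A * (e ^ (m - length A) * e ^ (length A + length W - m))
        \<le> r ^ length A * (r ^ (m - length A) * e ^ (length A + length W - m))"
      using e by (intro mult_left_mono mult_right_mono power_mono) auto
    also have "\<dots> = r ^ m * e ^ (length A + length W - m)"
      using True by (simp flip: mult.assoc power_add)
    finally show ?thesis by simp
  next
    case False
    \<comment> \<open>More than \<open>m\<close> vectors of \<open>M\<close> are dependent, so the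
      whole term vanishes.\<close>
    then have "gram q A = 0"
      using gram_zero_of_dim_less[OF q Nil.prems(2) M(1,2)] M(3) by simp
    then show ?thesis using e by (simp add: gram_append)
  qed
next
  case (Cons v V)
  obtain u w where v: "v = u + w" and u: "u \<in> M" "sqrt (q u u) \<le> r" and w: "sqrt (q w w) \<le> e"
    using Cons.prems(1)[of v] by auto
  let ?b = "2 ^ length V * (r ^ m * e ^ (length (v # V) + length A + length W - m))"
  \<comment> \<open>Splitting the head doubles the number of terms; \<open>u\<close> then joins
    \<open>A\<close> and \<open>w\<close> joins \<open>W\<close>, as order does not affect the
    volume.\<close>
  have "sqrt (gram q ((v # V) @ A @ W))
      \<le> sqrt (gram q (u # V @ A @ W)) + sqrt (gram q (w # V @ A @ W))"
    using sqrt_gram_Cons_add_le[OF q] v by simp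
  also have "gram q (u # V @ A @ W) = gram q (V @ (u # A) @ W)"
    by (rule gram_permute[OF q]) simp
  also have "gram q (w # V @ A @ W) = gram q (V @ A @ (w # W))"
    by (rule gram_permute[OF q]) simp
  also have "sqrt (gram q (V @ (u # A) @ W)) + sqrt (gram q (V @ A @ (w # W))) \<le> ?b + ?b"
  proof (rule add_mono)
    show "sqrt (gram q (V @ (u # A) @ W)) \<le> ?b"
      using Cons.IH[of "u # A" W] Cons.prems u by auto
    have "x \<in> set (w # W) \<Longrightarrow> sqrt (q x x) \<le> e" for x
      using Cons.prems(4) w by auto
    then show "sqrt (gram q (V @ A @ (w # W))) \<le> ?b"
      using Cons.IH[of A "w # W"] Cons.prems(1-3,5) by auto
  qed
  also have "?b + ?b = 2 ^ length (v # V) * (r ^ m * e ^ (length (v # V) + length A + length W - m))"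
    by simp
  finally show ?case .
qed

section \<open>Lower bound of the volume by distances\<close>

text \<open>The multiples subtracted in the successive eliminations add up to
  \<open>u\<close>.\<close>

lemma foldl_schur_residual:
  assumes "psd q"
  shows "\<exists>u\<in>span (set l). foldl schur q l x x = q (x - u) (x - u)"
  using assms
proof (induction l arbitrary: q)
  case Nil
  then show ?case by (simp add: span_empty)
next
  case (Cons a l)
  obtain u where u: "u \<in> span (set l)"
    and eq: "foldl schur (schur q a) l x x = schur q a (x - u) (x - u)"
    using Cons.IH[OF psd_schur[OF Cons.prems]] by blast
  obtain c where "schur q a (x - u) (x - u) = q (x - u - c *\<^sub>R a) (x - u - c *\<^sub>R a)"
    using schur_eq_residual[OF Cons.prems] .
  then have "foldl schur q (a # l) x x = q (x - (u + c *\<^sub>R a)) (x - (u + c *\<^sub>R a))"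
    using eq by (simp add: algebra_simps)
  moreover have "u + c *\<^sub>R a \<in> span (set (a # l))"
    by (rule span_add) (use u span_mono[of "set l" "set (a # l)"] in \<open>auto intro: span_scale span_base\<close>)
  ultimately show ?case by blast
qed

text \<open>The pivot of \<open>f n\<close> is \<open>q\<close> at \<open>f n - u\<close> with
  \<open>u\<close> in the span of the earlier vectors. Its root dominates the norm of
  \<open>f n - u\<close>, hence the distance, hence \<open>t\<close>; the pivots multiply.\<close>

lemma power_le_sqrt_gram:
  fixes f :: "nat \<Rightarrow> 'a::real_normed_vector"
  assumes q: "psd q" and "0 \<le> t"
    and lower: "\<And>x. x \<in> span (f ` {..<n}) \<Longrightarrow> norm x \<le> sqrt (q x x)"
    and far: "\<And>i. i < n \<Longrightarrow> t \<le> infdist (f i) (span (f ` {..<i}))"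
  shows "t ^ n \<le> sqrt (gram q (map f [0..<n]))"
  using lower far
proof (induction n)
  case (Suc n)
  have "span (f ` {..<n}) \<subseteq> span (f ` {..<Suc n})" by (intro span_mono image_mono) auto
  then have IH: "t ^ n \<le> sqrt (gram q (map f [0..<n]))"
    using Suc by (meson less_SucI subsetD)
  let ?p = "foldl schur q (map f [0..<n])"
  have set: "set (map f [0..<n]) = f ` {..<n}" by auto
  obtain u where u: "u \<in> span (f ` {..<n})" and eq: "?p (f n) (f n) = q (f n - u) (f n - u)"
    using foldl_schur_residual[OF q, of "map f [0..<n]"] unfolding set by blast
  have "t \<le> infdist (f n) (span (f ` {..<n}))" using Suc.prems(2) by simp
  also have "\<dots> \<le> norm (f n - u)" using infdist_le[OF u, of "f n"] by (simp add: dist_norm)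
  also have "\<dots> \<le> sqrt (?p (f n) (f n))" unfolding eq
    using u \<open>span (f ` {..<n}) \<subseteq> _\<close> by (intro Suc.prems(1) span_diff) (auto intro: span_base)
  finally have "t ^ n * t \<le> sqrt (gram q (map f [0..<n])) * sqrt (?p (f n) (f n))"
    using IH \<open>0 \<le> t\<close> by (intro mult_mono) (auto simp: gram_nonneg q)
  then show ?case by (simp add: gram_append real_sqrt_mult mult.commute)
qed simp

section \<open>Near-optimal subspaces and Euclidean structures\<close>

text \<open>The infima over subspaces and over approximants need not be attained; the slack from
  \<open>c\<close> to \<open>2 * c\<close> provides witnesses for both. The dimension is only
  bounded by \<open>m\<close> because of the fallback clause in the width.\<close>

lemma kolmogorov_width_subspace:
  fixes K :: "'a::real_normed_vector set"
  assumes "kolmogorov_width m K \<le> ennreal c" and "c > 0"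
  obtains B where "finite B" "card B \<le> m" "dim (span B) \<le> m"
    "\<And>x. x \<in> K \<Longrightarrow> \<exists>u\<in>span B. norm (x - u) \<le> 2 * c"
proof -
  let ?I = "if (n_dim_subspaces m :: 'a set set) \<noteq> {} then n_dim_subspaces m
               else (\<Union>k\<le>m. n_dim_subspaces k :: 'a set set)"
  have "kolmogorov_width m K < ennreal (2 * c)"
    using assms by (auto intro: le_less_trans simp: ennreal_less_iff)
  then obtain L where L: "L \<in> ?I" and sup: "(SUP f\<in>K. ennreal (infdist f L)) < ennreal (2 * c)"
    unfolding kolmogorov_width_def by (auto simp: INF_less_iff simp del: UN_iff)
  have "subspace L \<and> (\<exists>B. finite B \<and> span B = L) \<and> dim L \<le> m"
    using L by (auto simp: n_dim_subspaces_def split: if_splits)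
  then obtain F where F: "subspace L" "finite F" "span F = L" "dim L \<le> m" by blast
  obtain B where B: "B \<subseteq> L" "independent B" "L \<subseteq> span B" "card B = dim L"
    using basis_exists by blast
  have "finite B" using independent_span_bound[OF F(2) B(2)] B(1) F(3) by blast
  have span: "span B = L" using B(1,3) F(1) by (metis span_minimal subset_antisym)
  show ?thesis
  proof (rule that[of B])
    fix x assume "x \<in> K"
    then have "ennreal (infdist x L) < ennreal (2 * c)"
      using sup by (meson SUP_upper le_less_trans)
    then have "infdist x L < 2 * c" by (simp add: ennreal_less_iff infdist_nonneg)
    \<comment> \<open>\<open>infdist\<close> to the empty set is \<open>0\<close> by default, so an
      approximant exists only once \<open>L\<close> is known to be nonempty.\<close>
    moreover have "L \<noteq> {}" using F(1) subspace_0 by blast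
    ultimately obtain u where "u \<in> L" "dist x u < 2 * c"
      using infdist_attains_inf cINF_less_iff[of L "dist x" "2 * c"]
      by (auto simp: infdist_def)
    then show "\<exists>u\<in>span B. norm (x - u) \<le> 2 * c" unfolding span
      by (intro bexI[of _ u]) (simp_all add: dist_norm)
  qed (use \<open>finite B\<close> B F span in auto)
qed

section \<open>Euclidean structures from Banach-Mazur distances\<close>

lemma op_norm_upper:
  assumes "x \<in> vecs Y" "vnorm Y x \<le> 1" "op_norm Y Z T < \<infinity>"
  shows "vnorm Z (T x) \<le> enn2real (op_norm Y Z T)"
proof -
  have "ennreal (vnorm Z (T x)) \<le> op_norm Y Z T"
    unfolding op_norm_def using assms(1,2) by (intro SUP_upper) auto
  then show ?thesis using assms(3)
    by (metis enn2real_nonneg ennreal_enn2real ennreal_le_iff infinity_ennreal_def)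
qed

text \<open>The Euclidean inner product is pulled back along a near-optimal isomorphism
  \<open>T\<close> and scaled by the square of the norm \<open>b\<close> of its inverse. This makes
  the lower constant \<open>1\<close> and the upper one \<open>a * b\<close>, where \<open>a\<close>
  is the norm of \<open>T\<close>.\<close>

lemma psd_of_bm_gamma:
  fixes V :: "'a::real_normed_vector set"
  assumes V: "V \<in> n_dim_subspaces k" and "bm_gamma TYPE('a) k \<le> ennreal c" and "c > 0"
  obtains q where "psd q" "\<And>x. x \<in> V \<Longrightarrow> norm x \<le> sqrt (q x x)"
    "\<And>x. x \<in> V \<Longrightarrow> sqrt (q x x) \<le> 2 * c * norm x"
proof -
  let ?Y = "subspace_nspace V" and ?Z = "ell2 k"
  have sub: "subspace V" using V by (simp add: n_dim_subspaces_def)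
  have "banach_mazur_dist ?Y ?Z \<le> bm_gamma TYPE('a) k"
    unfolding bm_gamma_def using V by (rule SUP_upper)
  also have "\<dots> < ennreal (2 * c)"
    using assms(2,3) by (auto intro: le_less_trans simp: ennreal_less_iff)
  finally obtain T where T: "isomorphism_between ?Y ?Z T"
    and less: "op_norm ?Y ?Z T * op_norm ?Z ?Y (inv_into (vecs ?Y) T) < ennreal (2 * c)"
    unfolding banach_mazur_dist_def by (auto simp: INF_less_iff)
  define S where "S = inv_into V T"
  define a where "a = enn2real (op_norm ?Y ?Z T)"
  define b where "b = enn2real (op_norm ?Z ?Y S)"
  have vY: "vecs ?Y = V" by (simp add: subspace_nspace_def)
  have lin: "linear_between ?Y ?Z T" and bij: "bij_betw T V (vecs ?Z)"
    and fin: "op_norm ?Y ?Z T < \<infinity>" "op_norm ?Z ?Y S < \<infinity>"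
    using T unfolding isomorphism_between_def S_def vY by auto
  have add: "T (x + y) = (\<lambda>i. T x i + T y i)" if "x \<in> V" "y \<in> V" for x y
    using lin that unfolding linear_between_def by (simp add: subspace_nspace_def ell2_def)
  have scale: "T (r *\<^sub>R x) = (\<lambda>i. r * T x i)" if "x \<in> V" for r x
    using lin that unfolding linear_between_def by (simp add: subspace_nspace_def ell2_def)
  have mem: "T x \<in> vecs ?Z" if "x \<in> V" for x using bij that by (auto simp: bij_betw_def)
  have T0: "T 0 = (\<lambda>i. 0)" using scale[of 0 0] sub by (simp add: subspace_0)
  let ?N = "\<lambda>x. L2_set (T x) {..<k}"
  have ab: "a * b \<le> 2 * c"
  proof -
    have "ennreal (a * b) < ennreal (2 * c)"
      using less fin unfolding a_def b_def vY S_def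
      by (simp add: ennreal_mult)
    then show ?thesis by (simp add: ennreal_less_iff a_def b_def)
  qed
  have upper: "?N x \<le> a * norm x" if x: "x \<in> V" for x
  proof (cases "x = 0")
    case True
    then show ?thesis by (simp add: T0 L2_set_def)
  next
    case False
    have "(1 / norm x) *\<^sub>R x \<in> V" using sub x by (rule subspace_scale)
    then have "vnorm ?Z (T ((1 / norm x) *\<^sub>R x)) \<le> a"
      unfolding a_def using False fin(1)
      by (intro op_norm_upper) (auto simp: subspace_nspace_def)
    then have "(1 / norm x) * ?N x \<le> a"
      unfolding scale[OF x] by (simp add: ell2_def del: times_divide_eq_left flip: L2_set_right_distrib)
    then show ?thesis using False by (simp add: field_simps)
  qed
  have lower: "norm x \<le> b * ?N x" if x: "x \<in> V" for x
  proof (cases "?N x = 0")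
    case True
    \<comment> \<open>Coordinates from \<open>k\<close> on vanish by the encoding of
      \<open>ell2\<close>, the earlier ones because their L2 norm is zero.\<close>
    then have "T x i = 0" for i
      using mem[OF x] by (cases "i < k") (auto simp: L2_set_eq_0_iff ell2_def)
    then have "T x = T 0" by (auto simp: T0)
    then have "x = 0" using bij x subspace_0[OF sub] by (auto simp: bij_betw_def inj_on_def)
    then show ?thesis by (simp add: T0 L2_set_def)
  next
    case False
    then have pos: "?N x > 0" using L2_set_nonneg[of "T x"] by (metis less_eq_real_def)
    \<comment> \<open>Scaled so that its image has Euclidean norm \<open>1\<close>; the norm of the
      inverse then bounds \<open>?y\<close>.\<close>
    let ?y = "(1 / ?N x) *\<^sub>R x"
    have y: "?y \<in> V" using sub x by (rule subspace_scale)
    have "vnorm ?Z (T ?y) = L2_set (\<lambda>i. (1 / ?N x) * T x i) {..<k}"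
      by (simp only: scale[OF x]) (simp add: ell2_def)
    also have "\<dots> = (1 / ?N x) * ?N x"
      by (rule L2_set_right_distrib[symmetric]) simp
    also have "\<dots> = 1" using pos by simp
    finally have y1: "vnorm ?Z (T ?y) \<le> 1" by (rule eq_refl)
    have "vnorm ?Y (S (T ?y)) \<le> b"
      unfolding b_def by (rule op_norm_upper[OF mem[OF y] y1 fin(2)])
    moreover have "S (T ?y) = ?y" unfolding S_def using bij y by (auto simp: bij_betw_def)
    ultimately have "norm ?y \<le> b" by (simp only: subspace_nspace_def nspace.select_convs)
    moreover have "norm ?y = norm x / ?N x" using pos by simp
    ultimately show ?thesis using pos by (simp only: pos_divide_le_eq)
  qed
  obtain B where B: "B \<subseteq> V" "independent B" "V \<subseteq> span B"
    using basis_exists[of V] by metis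
  \<comment> \<open>\<open>T\<close> is linear only on \<open>V\<close>, whereas \<open>psd\<close>
    asks for a form on the whole type; each coordinate is therefore extended from a basis of
    \<open>V\<close>.\<close>
  have "\<exists>g. linear g \<and> (\<forall>x\<in>V. g x = T x i)" for i
  proof -
    obtain g :: "'a \<Rightarrow> real" where g: "linear g" "\<forall>x\<in>B. g x = T x i"
      using linear_independent_extend[OF B(2), of "\<lambda>x. T x i"] by auto
    have "subspace {x \<in> V. g x = T x i}"
      using sub g(1) unfolding subspace_def
      by (simp add: T0 add scale linear_0 linear_add linear_scale)
    moreover have "B \<subseteq> {x \<in> V. g x = T x i}" using B(1) g(2) by auto
    ultimately have "span B \<subseteq> {x \<in> V. g x = T x i}" by (simp add: span_minimal)
    then show ?thesis using B(3) g(1) by blast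
  qed
  then obtain g :: "nat \<Rightarrow> 'a \<Rightarrow> real"
    where g: "\<And>i. linear (g i)" "\<And>i x. x \<in> V \<Longrightarrow> g i x = T x i" by metis
  define q where "q = (\<lambda>x y. b\<^sup>2 * (\<Sum>i<k. g i x * g i y))"
  have "psd q"
    unfolding psd_def
  proof (intro conjI allI)
    fix x y
    show "linear (\<lambda>x. q x y)"
      by (rule linearI) (simp_all add: q_def linear_add[OF g(1)] linear_scale[OF g(1)]
          distrib_left distrib_right sum.distrib sum_distrib_left mult_ac)
    show "q x y = q y x" by (simp add: q_def mult.commute)
    show "0 \<le> q x x" by (simp add: q_def sum_nonneg)
  qed
  have "b \<ge> 0" by (simp add: b_def)
  then have sqrt_q: "sqrt (q x x) = b * ?N x" if "x \<in> V" for x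
    using g(2)[OF that] by (simp add: q_def real_sqrt_mult L2_set_def power2_eq_square)
  show ?thesis
  proof (rule that[of q])
    fix x assume x: "x \<in> V"
    show "norm x \<le> sqrt (q x x)" using lower[OF x] sqrt_q[OF x] by simp
    have "b * ?N x \<le> b * (a * norm x)" using upper[OF x] \<open>b \<ge> 0\<close> by (rule mult_left_mono)
    also have "\<dots> \<le> 2 * c * norm x" using mult_right_mono[OF ab, of "norm x"] by (simp add: mult_ac)
    finally show "sqrt (q x x) \<le> 2 * c * norm x" using sqrt_q[OF x] by simp
  qed (rule \<open>psd q\<close>)
qed

text \<open>The actual dimension may be any number up to \<open>N\<close>. Dimension
  \<open>0\<close> lies outside the bound on \<open>bm_gamma\<close> and is served by the zero
  form.\<close>

lemma psd_of_finite_span: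
  fixes F :: "'a::real_normed_vector set"
  assumes F: "finite F" "card F \<le> N" and "c > 0"
    and gamma: "\<And>k. 1 \<le> k \<Longrightarrow> k \<le> N \<Longrightarrow> bm_gamma TYPE('a) k \<le> ennreal c"
  obtains q where "psd q" "\<And>x. x \<in> span F \<Longrightarrow> norm x \<le> sqrt (q x x)"
    "\<And>x. x \<in> span F \<Longrightarrow> sqrt (q x x) \<le> 2 * c * norm x"
proof (cases "dim (span F) = 0")
  case True
  obtain B where B: "B \<subseteq> span F" "independent B" "span F \<subseteq> span B" "card B = dim (span F)"
    using basis_exists by blast
  have "finite B" using independent_span_bound[OF F(1) B(2,1)] by blast
  then have "span F \<subseteq> {0}" using B(3,4) True by simp
  moreover have "psd (\<lambda>(_::'a) (_::'a). 0)" by (simp add: psd_def linearI)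
  ultimately show ?thesis using \<open>c > 0\<close> by (intro that[of "\<lambda>_ _. 0"]) auto
next
  case False
  have "dim (span F) \<le> N" using dim_le_card[of "span F" F] F by simp
  moreover have "span F \<in> n_dim_subspaces (dim (span F))"
    using F(1) by (auto simp: n_dim_subspaces_def)
  ultimately show ?thesis
    using psd_of_bm_gamma[of "span F" "dim (span F)" c] gamma[of "dim (span F)"] \<open>c > 0\<close> False that
    by (metis One_nat_def Suc_leI neq0_conv)
qed

section \<open>The greedy error\<close>

text \<open>\<open>f n\<close> was already a candidate at step \<open>i\<close>, so
  \<open>f i\<close> is at least as far from the smaller space. For \<open>i = 0\<close> that space
  is \<open>{0}\<close> and the distance is the norm.\<close>

lemma greedy_error_le_infdist:
  assumes f: "greedy_sequence K f" and "i < n"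
  shows "greedy_error f n \<le> infdist (f i) (span (f ` {..<i}))"
proof (cases "i = 0")
  case True
  have "greedy_error f n \<le> dist (f n) 0"
    using assms(2) infdist_le[OF span_zero, of "f n" "f ` {..<n}"]
    by (simp add: greedy_error_def greedy_space_def)
  also have "\<dots> \<le> norm (f 0)" using f by (auto simp: greedy_sequence_def)
  finally show ?thesis using True by (simp add: span_empty)
next
  case False
  have "span (f ` {..<i}) \<subseteq> span (f ` {..<n})" using assms(2) by (intro span_mono) auto
  then have "greedy_error f n \<le> infdist (f n) (span (f ` {..<i}))"
    using assms(2) span_zero by (auto simp: greedy_error_def greedy_space_def intro!: infdist_mono)
  also have "\<dots> \<le> infdist (f i) (span (f ` {..<i}))"
    using f False unfolding greedy_sequence_def greedy_space_def by simp
  finally show ?thesis .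
qed

lemma greedy_error_power_le:
  fixes K :: "'a::real_normed_vector set"
  assumes K: "K \<subseteq> cball 0 1" and f: "greedy_sequence K f"
    and "c > 0" "\<delta> > 0" "C > 0" "\<delta> \<le> 1" and "m \<le> n"
    and gamma: "\<And>k. 1 \<le> k \<Longrightarrow> k \<le> n + m \<Longrightarrow> bm_gamma TYPE('a) k \<le> ennreal c"
    and width: "kolmogorov_width m K \<le> ennreal (C * \<delta>)"
  shows "greedy_error f n ^ n \<le> (4 * c * (1 + 2 * C)) ^ n * \<delta> ^ (n - m)"
proof -
  obtain B where B: "finite B" "card B \<le> m" "dim (span B) \<le> m"
    and approx: "\<And>x. x \<in> K \<Longrightarrow> \<exists>u\<in>span B. norm (x - u) \<le> 2 * (C * \<delta>)"
    using kolmogorov_width_subspace[OF width] \<open>C > 0\<close> \<open>\<delta> > 0\<close> by auto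
  \<comment> \<open>Both the greedy vectors and \<open>B\<close> are included, since the remainders
    \<open>v - u\<close> must be measured by \<open>q\<close> too.\<close>
  let ?F = "f ` {..<n} \<union> B"
  have "card ?F \<le> n + m"
    using card_Un_le[of "f ` {..<n}" B] card_image_le[of "{..<n}" f] B(2) by simp
  then obtain q where q: "psd q" and lower: "\<And>x. x \<in> span ?F \<Longrightarrow> norm x \<le> sqrt (q x x)"
    and upper: "\<And>x. x \<in> span ?F \<Longrightarrow> sqrt (q x x) \<le> 2 * c * norm x"
    using psd_of_finite_span[of ?F "n + m" c] B(1) \<open>c > 0\<close> gamma by blast
  \<comment> \<open>Approximants have norm at most \<open>1 + 2 * C\<close>, and \<open>q\<close>
    costs a factor \<open>2 * c\<close>.\<close>
  define r where "r = 2 * c * (1 + 2 * C)"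
  \<comment> \<open>Remainders have size at most \<open>4 * c * C * \<delta>\<close>, which is below
    \<open>r * \<delta>\<close>; this form lets the powers of \<open>r\<close> combine to
    \<open>r ^ n\<close>.\<close>
  define e where "e = r * \<delta>"
  have "r > 0" using assms by (simp add: r_def add_pos_pos)
  have e: "0 \<le> e" "e \<le> r" using \<open>r > 0\<close> assms by (auto simp: e_def mult_le_cancel_left1)
  let ?V = "map f [0..<n]"
  have split: "\<exists>u w. v = u + w \<and> u \<in> span B \<and> sqrt (q u u) \<le> r \<and> sqrt (q w w) \<le> e"
    if "v \<in> set ?V" for v
  proof -
    have v: "v \<in> f ` {..<n}" using that by auto
    have "v \<in> K" using v f by (auto simp: greedy_sequence_def)
    then obtain u where u: "u \<in> span B" "norm (v - u) \<le> 2 * (C * \<delta>)" using approx by blast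
    have "norm v \<le> 1" using K \<open>v \<in> K\<close> by auto
    moreover have "norm u \<le> norm v + norm (v - u)" using norm_triangle_ineq4[of v "v - u"] by simp
    moreover have "C * \<delta> \<le> C" using assms by (simp add: mult_le_cancel_left1)
    ultimately have nu: "norm u \<le> 1 + 2 * C" using u(2) by linarith
    have uF: "u \<in> span ?F" using u(1) span_mono[of B ?F] by auto
    have wF: "v - u \<in> span ?F" using v uF by (intro span_diff) (auto intro: span_base)
    have "2 * c * norm u \<le> r" unfolding r_def using nu \<open>c > 0\<close> by simp
    then have "sqrt (q u u) \<le> r" using upper[OF uF] by linarith
    moreover have "2 * c * norm (v - u) \<le> 2 * c * (2 * (C * \<delta>))" using u(2) \<open>c > 0\<close> by simp
    then have "2 * c * norm (v - u) \<le> e"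
      using mult_pos_pos[OF \<open>c > 0\<close> \<open>\<delta> > 0\<close>] by (simp add: e_def r_def algebra_simps)
    then have "sqrt (q (v - u) (v - u)) \<le> e" using upper[OF wF] by linarith
    ultimately show ?thesis using u(1) by (intro exI[of _ u] exI[of _ "v - u"]) auto
  qed
  have "greedy_error f n ^ n \<le> sqrt (gram q ?V)"
  proof (rule power_le_sqrt_gram[OF q])
    show "0 \<le> greedy_error f n" by (simp add: greedy_error_def infdist_nonneg)
    show "norm x \<le> sqrt (q x x)" if "x \<in> span (f ` {..<n})" for x
      using that span_mono[of "f ` {..<n}" ?F] by (intro lower) auto
  qed (rule greedy_error_le_infdist[OF f])
  also have "\<dots> \<le> 2 ^ n * (r ^ m * e ^ (n - m))"
    using sqrt_gram_expand[OF q B(1) subset_refl B(3) e split, of ?V "[]" "[]"] \<open>m \<le> n\<close> by simp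
  also have "\<dots> = 2 ^ n * (r ^ m * r ^ (n - m)) * \<delta> ^ (n - m)"
    by (simp add: e_def power_mult_distrib)
  also have "r ^ m * r ^ (n - m) = r ^ n" using \<open>m \<le> n\<close> by (simp flip: power_add)
  also have "2 ^ n * r ^ n = (4 * c * (1 + 2 * C)) ^ n"
    unfolding r_def by (simp flip: power_mult_distrib add: mult_ac)
  finally show ?thesis .
qed

text \<open>The choice \<open>m \<approx> n / ln n\<close>: then \<open>m powr (m / n)\<close> stays bounded, while replacing \<open>n\<close> by \<open>m\<close>
  costs only a logarithm.\<close>

lemma logarithmic_fraction:
  assumes "n \<ge> 1"
  obtains m where "1 \<le> m" "m \<le> n"
    "real m powr (- (1 - real m / real n)) \<le> exp 2 * (ln (real n + 2) / real n)"
proof -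
  define l where "l = ln (real n + 2)"
  define m where "m = nat \<lceil>real n / l\<rceil>"
  \<comment> \<open>The shift by \<open>2\<close> ensures \<open>l \<ge> 1\<close>, hence
    \<open>m \<le> n\<close>.\<close>
  have "exp 1 \<le> real n + 2" using exp_le assms by linarith
  then have l: "l \<ge> 1" unfolding l_def by (simp add: ln_ge_iff)
  have pos: "real n / l > 0" using l assms by simp
  then have m1: "m \<ge> 1" unfolding m_def by linarith
  have lo: "real n / l \<le> m" and hi: "m \<le> real n / l + 1" using pos unfolding m_def by linarith+
  have "real n / l \<le> real n" using l by (simp add: divide_le_eq mult_le_cancel_left1)
  then have mn: "m \<le> n" unfolding m_def by linarith
  have "real m / real n \<le> 1 / l + 1 / real n"
    using hi assms l by (simp add: field_simps)
  moreover have "0 \<le> ln (real m)" "ln (real m) \<le> ln (real n)" using m1 mn by auto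
  \<comment> \<open>The exponent of \<open>real m powr (real m / real n)\<close>;
    \<open>1 / l\<close> and the rounding error \<open>1 / real n\<close> each contribute at most
    \<open>1\<close>.\<close>
  ultimately have "real m / real n * ln (real m) \<le> (1 / l + 1 / real n) * ln (real n)"
    using l by (intro mult_mono) auto
  also have "\<dots> = ln (real n) / l + ln (real n) / real n" by (simp add: distrib_right)
  also have "\<dots> \<le> 1 + 1"
  proof (rule add_mono)
    show "ln (real n) / l \<le> 1" using assms l unfolding l_def by (simp add: divide_le_eq)
    show "ln (real n) / real n \<le> 1" using assms ln_bound[of "real n"] by (simp add: divide_le_eq)
  qed
  finally have "real m powr (real m / real n) \<le> exp 2" using m1 by (simp add: powr_def)
  moreover have "1 / real m \<le> l / real n" using lo pos m1 l assms by (simp add: field_simps)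
  ultimately have "real m powr (real m / real n) * (1 / real m) \<le> exp 2 * (l / real n)"
    by (intro mult_mono) auto
  moreover have "real m powr (- (1 - real m / real n)) = real m powr (real m / real n) * (1 / real m)"
    using m1 by (simp add: powr_diff)
  ultimately show ?thesis using that[of m] m1 mn unfolding l_def by simp
qed

section \<open>The final estimate\<close>

theorem theorem3p1:
  fixes K :: "'a::banach set" and C\<^sub>1 C\<^sub>2 \<mu> s :: real
  assumes "compact K" and "K \<noteq> {}" and "K \<subseteq> cball 0 1"
    and "C\<^sub>1 > 0" and "C\<^sub>2 > 0"
    and "0 < \<mu>" and "\<mu> \<le> 1/2" and "s > \<mu>"
    and "\<forall>n\<ge>1. bm_gamma TYPE('a) n \<le> ennreal (C\<^sub>1 * real n powr \<mu>)"
    and "\<forall>n\<ge>1. kolmogorov_width n K \<le> ennreal (C\<^sub>2 * real n powr (- s))"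
  shows "\<exists>C>0. \<forall>f. greedy_sequence K f \<longrightarrow>
    (\<forall>n\<ge>1. greedy_error f n \<le> C * real n powr (- s + \<mu>) * ln (real n + 2) powr s)"
proof -
  \<comment> \<open>Independent of \<open>f\<close> and \<open>n\<close>; the factor
    \<open>2 powr \<mu>\<close> comes from dimensions up to \<open>2 * n\<close>.\<close>
  define A where "A = 4 * (C\<^sub>1 * 2 powr \<mu>) * (1 + 2 * C\<^sub>2)"
  have "A > 0" using assms by (simp add: A_def add_pos_pos)
  have "s > 0" using assms by simp
  have "greedy_error f n \<le> (A * exp (2 * s)) * real n powr (- s + \<mu>) * ln (real n + 2) powr s"
    if f: "greedy_sequence K f" and n: "n \<ge> 1" for f n
  proof -
    obtain m where m: "1 \<le> m" "m \<le> n"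
      and frac: "real m powr (- (1 - real m / real n)) \<le> exp 2 * (ln (real n + 2) / real n)"
      using logarithmic_fraction[OF n] .
    define c where "c = C\<^sub>1 * (2 * real n) powr \<mu>"
    define \<delta> where "\<delta> = real m powr (- s)"
    \<comment> \<open>Chosen so that \<open>t ^ n = \<delta> ^ (n - m)\<close>, which allows taking
      an \<open>n\<close>-th root.\<close>
    define t where "t = (real m powr (- (1 - real m / real n))) powr s"
    have "c > 0" using assms n by (simp add: c_def)
    have \<delta>: "\<delta> > 0" "\<delta> \<le> 1" using m \<open>s > 0\<close> by (auto simp: \<delta>_def powr_minus inverse_le_1_iff ge_one_powr_ge_zero)
    have gamma: "bm_gamma TYPE('a) k \<le> ennreal c" if k: "1 \<le> k" "k \<le> n + m" for k
    proof -
      have "bm_gamma TYPE('a) k \<le> ennreal (C\<^sub>1 * real k powr \<mu>)" using assms(9) k by simp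
      also have "\<dots> \<le> ennreal c"
        unfolding c_def using k m assms by (intro ennreal_leI mult_left_mono powr_mono2) auto
      finally show ?thesis .
    qed
    have width: "kolmogorov_width m K \<le> ennreal (C\<^sub>2 * \<delta>)"
      unfolding \<delta>_def using assms(10) m by simp
    have t: "\<delta> ^ (n - m) = t ^ n"
    proof -
      have "real (n - m) * - s = real n * (- (1 - real m / real n) * s)"
        using m n by (simp add: of_nat_diff field_simps)
      then show ?thesis
        using m unfolding \<delta>_def t_def by (simp only: powr_powr powr_power)
    qed
    have "greedy_error f n ^ n \<le> (4 * c * (1 + 2 * C\<^sub>2)) ^ n * \<delta> ^ (n - m)"
      using greedy_error_power_le[OF assms(3) f \<open>c > 0\<close> \<delta>(1) \<open>C\<^sub>2 > 0\<close> \<delta>(2) m(2) gamma width] .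
    also have "4 * c * (1 + 2 * C\<^sub>2) = A * real n powr \<mu>"
      by (simp add: A_def c_def powr_mult)
    finally have "greedy_error f n ^ n \<le> (A * real n powr \<mu> * t) ^ n"
      by (simp add: t power_mult_distrib)
    moreover have "0 \<le> A * real n powr \<mu> * t" using \<open>A > 0\<close> by (simp add: t_def)
    ultimately have "greedy_error f n \<le> A * real n powr \<mu> * t"
      using n power_mono_iff[of "greedy_error f n" "A * real n powr \<mu> * t" n]
      by (simp add: greedy_error_def infdist_nonneg)
    also have "\<dots> \<le> A * real n powr \<mu> * (exp 2 * (ln (real n + 2) / real n)) powr s"
      unfolding t_def using frac \<open>s > 0\<close> \<open>A > 0\<close>
      by (intro mult_left_mono powr_mono2) auto
    also have "(exp 2 * (ln (real n + 2) / real n)) powr s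
        = exp (2 * s) * (ln (real n + 2) powr s * real n powr (- s))"
    proof -
      have "exp 2 powr s = exp (2 * s)" by (simp add: powr_def mult.commute)
      moreover have "(ln (real n + 2) / real n) powr s = ln (real n + 2) powr s * real n powr (- s)"
        by (simp add: powr_divide powr_minus_divide)
      ultimately show ?thesis by (simp add: powr_mult del: times_divide_eq_right)
    qed
    finally show ?thesis by (simp only: powr_add mult_ac)
  qed
  then show ?thesis using \<open>A > 0\<close> by (intro exI[of _ "A * exp (2 * s)"]) auto
qed

end
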